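(* For every edge-ordered graph $\mathfrak{G}$, the edge-ordered Ramsey number $\overline{R}_e(\mathfrak{G})$ is finite. That is, there exist a positive integer $N$ and an edge-ordering $\mathfrak{K}_N$ of the complete graph $K_N$ such that every 2-coloring of the edges of $\mathfrak{K}_N$ contains a monochromatic copy of $\mathfrak{G}$ as an edge-ordered subgraph of $\mathfrak{K}_N$.
   Context: All graphs are finite and simple. An edge-ordered graph $\mathfrak{G}=(G,\prec)$ consists of a graph $G=(V,E)$ and a linear ordering $\prec$ of its edge set $E$; $\mathfrak{G}$ (or $\prec$) is also called an edge-ordering of $G$. An edge-ordered graph $(G,\prec_1)$ is an edge-ordered subgraph of $(H,\prec_2)$ if $G$ is a (not necessarily induced) subgraph of $H$ and $\prec_1$ is a suborder of $\prec_2$ (i.e. the restriction of $\prec_2$ to $E(G)$). Two edge-ordered graphs are isomorphic if there is a graph isomorphism between them that preserves the edge-orderings. A copy of $\mathfrak{G}$ in $\mathfrak{K}_N$ is an edge-ordered subgraph of $\mathfrak{K}_N$ isomorphic to $\mathfrak{G}$; it is monochromatic if all its edges have the same color. A $k$-coloring of the edges of a graph assigns one of $k$ colors to each edge. The edge-ordered Ramsey number $\overline{R}_e(\mathfrak{G})$ is the minimum positive integer $N$ such that there exists an edge-ordering $\mathfrak{K}_N$ of the complete graph $K_N$ on $N$ vertices such that every 2-coloring of the edges of $\mathfrak{K}_N$ contains a monochromatic copy of $\mathfrak{G}$ as an edge-ordered subgraph of $\mathfrak{K}_N$. *)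

theory Defs
  imports "HOL-Library.Ramsey" "HOL-Library.Extended_Nat"
begin

text \<open>An edge is a two-element set of vertices; \<^term>\<open>[V]\<^bsup>2\<^esup>\<close> is the edge set of the complete
  graph on \<^term>\<open>V\<close>. The third component is the strict order on the edges, a pair
  \<^term>\<open>(e, e')\<close> meaning that \<^term>\<open>e\<close> precedes \<^term>\<open>e'\<close>.\<close>

datatype 'a eograph = EOGraph (verts: "'a set") (edges: "'a set set") (eord: "'a set rel")

text \<open>\<^const>\<open>strict_linear_order_on\<close> does not confine the relation to its carrier, so this is
  required separately.\<close>

definition edge_ordered_graph :: "'a eograph \<Rightarrow> bool" where
  "edge_ordered_graph G \<longleftrightarrow>
     finite (verts G) \<and>
     edges G \<subseteq> [verts G]\<^bsup>2\<^esup> \<and>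
     eord G \<subseteq> edges G \<times> edges G \<and>
     strict_linear_order_on (edges G) (eord G)"

definition eo_subgraph :: "'a eograph \<Rightarrow> 'a eograph \<Rightarrow> bool" where
  "eo_subgraph G H \<longleftrightarrow>
     edge_ordered_graph G \<and> edge_ordered_graph H \<and>
     verts G \<subseteq> verts H \<and>
     edges G \<subseteq> edges H \<and>
     eord G = eord H \<inter> (edges G \<times> edges G)"

definition eo_isomorphic :: "'a eograph \<Rightarrow> 'b eograph \<Rightarrow> bool" where
  "eo_isomorphic G H \<longleftrightarrow>
     (\<exists>f. bij_betw f (verts G) (verts H) \<and>
          (\<forall>u\<in>verts G. \<forall>v\<in>verts G. {u, v} \<in> edges G \<longleftrightarrow> {f u, f v} \<in> edges H) \<and>
          (\<forall>e\<in>edges G. \<forall>e'\<in>edges G. (e, e') \<in> eord G \<longleftrightarrow> (f ` e, f ` e') \<in> eord H))"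

definition eo_copy :: "'a eograph \<Rightarrow> 'b eograph \<Rightarrow> 'b eograph \<Rightarrow> bool" where
  "eo_copy G H K \<longleftrightarrow> eo_subgraph H K \<and> eo_isomorphic G H"

definition edge_ordering_of_complete :: "nat \<Rightarrow> nat eograph \<Rightarrow> bool" where
  "edge_ordering_of_complete N K \<longleftrightarrow>
     edge_ordered_graph K \<and> verts K = {..<N} \<and> edges K = [{..<N}]\<^bsup>2\<^esup>"

definition edge_coloring :: "nat \<Rightarrow> 'a eograph \<Rightarrow> ('a set \<Rightarrow> nat) \<Rightarrow> bool" where
  "edge_coloring k G c \<longleftrightarrow> c \<in> edges G \<rightarrow> {..<k}"

definition eo_monochromatic :: "('a set \<Rightarrow> nat) \<Rightarrow> 'a eograph \<Rightarrow> bool" where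
  "eo_monochromatic c H \<longleftrightarrow> (\<forall>e\<in>edges H. \<forall>e'\<in>edges H. c e = c e')"

definition eo_arrows :: "nat eograph \<Rightarrow> 'a eograph \<Rightarrow> bool" where
  "eo_arrows K G \<longleftrightarrow>
     (\<forall>c. edge_coloring 2 K c \<longrightarrow> (\<exists>H. eo_copy G H K \<and> eo_monochromatic c H))"

text \<open>The minimum is taken in the extended naturals, so the value is \<open>\<infinity>\<close> exactly when no
  suitable \<open>N\<close> exists.\<close>

definition edge_ordered_Ramsey :: "'a eograph \<Rightarrow> enat" where
  "edge_ordered_Ramsey G =
     Inf {enat N | N. N > 0 \<and> (\<exists>K. edge_ordering_of_complete N K \<and> eo_arrows K G)}"

end

theory Submission
  imports Defs
begin

text \<open>Vertices of the complete graph are functions from \<open>{..<M}\<close> to \<open>{..<R}\<close>, and the edge ordering refines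
  the label of an edge, which is the first coordinate where its two ends agree. By Ramsey's theorem
  the values can be restricted so that the colour of an edge with a single tie \<open>j\<close> depends only on
  \<open>j\<close> and on the set \<open>D\<close> of coordinates where the first end is the larger one. A second application,
  to the set \<open>D \<union> {j}\<close> of coordinates, makes the colour depend only on the cardinality of this set
  and the rank of \<open>j\<close> in it.

  Given linearly ordered edges, coordinates come in pairs, one pair for each edge \<open>{p, q}\<close>: on the first
  coordinate of the pair, \<open>p\<close> and \<open>q\<close> are tied, and on the second the order of the vertices is
  reversed, with \<open>p\<close> and \<open>q\<close> in natural order. Any other edge is then inverted on exactly one of the
  two coordinates, so \<open>D \<union> {j}\<close> contains one coordinate of each pair, its cardinality is constant
  and the rank of \<open>j\<close> is the number of the pair. With about twice as many pairs as edges, the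
  pigeonhole principle provides enough ranks of the same colour.\<close>

section \<open>Ramsey's theorem and uniform colours\<close>

text \<open>Increasing lists stand for \<open>r\<close>-element sets, so that colourings can address
  elements by position. The numbering \<open>h\<close> admits any finite set \<open>C\<close> of
  colours, such as a power set, which handles many two-colourings at once.\<close>

lemma ramsey_lists:
  assumes "finite C"
  shows "\<exists>N::nat. \<forall>F. (\<forall>xs. F xs \<in> C) \<longrightarrow>
    (\<exists>ys c. strict_sorted ys \<and> set ys \<subseteq> {..<N} \<and> length ys = q \<and> c \<in> C \<and>
      (\<forall>xs. strict_sorted xs \<and> set xs \<subseteq> set ys \<and> length xs = r \<longrightarrow> F xs = c))"
proof -
  obtain h where h: "bij_betw h C {0..<card C}"
    using ex_bij_betw_finite_nat[OF assms] by blast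
  obtain N :: nat where N: "partn_lst {..<N} (replicate (card C) q) r"
    using ramsey_full by blast
  show ?thesis
  proof (intro exI[of _ N] allI impI)
    fix F :: "nat list \<Rightarrow> 'a" assume F: "\<forall>xs. F xs \<in> C"
    define f where "f = (\<lambda>A. h (F (sorted_list_of_set A)))"
    have "f \<in> [{..<N}]\<^bsup>r\<^esup> \<rightarrow> {..<card C}"
      using F h by (auto simp: f_def bij_betw_def)
    then obtain i H where i: "i < card C" and H: "H \<in> [{..<N}]\<^bsup>q\<^esup>" and Hf: "f ` [H]\<^bsup>r\<^esup> \<subseteq> {i}"
      using partn_lstE[OF N] by (metis length_replicate nth_replicate)
    define c where "c = inv_into C h i"
    have c: "c \<in> C"
      using h i unfolding c_def bij_betw_def by (metis atLeast0LessThan inv_into_into lessThan_iff)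
    have "F xs = c" if "strict_sorted xs" "set xs \<subseteq> H" "length xs = r" for xs
    proof -
      have "distinct xs" "sorted xs" using that strict_sorted_iff by auto
      hence "set xs \<in> [H]\<^bsup>r\<^esup>"
        using that by (auto simp: nsets_def distinct_card)
      hence "f (set xs) = i" using Hf by blast
      hence "h (F xs) = i"
        using \<open>distinct xs\<close> \<open>sorted xs\<close>
        by (simp add: f_def sorted_list_of_set_sort_remdups distinct_remdups_id sorted_sort_id)
      thus ?thesis
        using h F by (auto simp: c_def bij_betw_def)
    qed
    moreover have "finite H" using H by (auto simp: nsets_def)
    ultimately show "\<exists>ys c. strict_sorted ys \<and> set ys \<subseteq> {..<N} \<and> length ys = q \<and> c \<in> C \<and>
      (\<forall>xs. strict_sorted xs \<and> set xs \<subseteq> set ys \<and> length xs = r \<longrightarrow> F xs = c)"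
      using H c
      by (intro exI[of _ "sorted_list_of_set H"] exI[of _ c]) (auto simp: nsets_def)
  qed
qed

text \<open>One application of Ramsey's theorem to sets of \<open>2 * M\<close> values: each
  coordinate owns two consecutive values of the set, and the colour of the set records
  \<open>\<chi>\<close> for all patterns \<open>(D, j)\<close> at once. The alphabets
  \<open>y i\<close> are consecutive blocks of the homogeneous set, so every pair of functions over
  them with a single tie arises in this way.\<close>

lemma colour_by_comparison:
  fixes M W :: nat
  shows "\<exists>R. \<forall>\<chi> :: (nat \<Rightarrow> nat) \<Rightarrow> (nat \<Rightarrow> nat) \<Rightarrow> bool. \<exists>(y :: nat \<Rightarrow> nat \<Rightarrow> nat) \<Phi>.
     (\<forall>i<M. \<forall>a<W. y i a < R) \<and> (\<forall>i<M. inj_on (y i) {..<W}) \<and>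
     (\<forall>z z' j. (\<forall>i. z i < W \<and> z' i < W) \<and> j < M \<and> {i. i < M \<and> z i = z' i} = {j} \<longrightarrow>
        \<chi> (\<lambda>i\<in>{..<M}. y i (z i)) (\<lambda>i\<in>{..<M}. y i (z' i))
          = (({i. i < M \<and> z' i < z i}, j) \<in> \<Phi>))"
proof -
  let ?C = "Pow (Pow {..<M} \<times> {..<M})"
  have "finite ?C" by simp
  from ramsey_lists[OF this, where q = "M * Suc W" and r = "2 * M"]
  obtain R :: nat where R: "\<forall>F. (\<forall>xs. F xs \<in> ?C) \<longrightarrow>
    (\<exists>ys \<Phi>. strict_sorted ys \<and> set ys \<subseteq> {..<R} \<and> length ys = M * Suc W \<and> \<Phi> \<in> ?C \<and>
      (\<forall>xs. strict_sorted xs \<and> set xs \<subseteq> set ys \<and> length xs = 2 * M \<longrightarrow> F xs = \<Phi>))"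
    by (elim exE) (rule that)
  show ?thesis
  proof (intro exI[of _ R] allI)
    fix \<chi> :: "(nat \<Rightarrow> nat) \<Rightarrow> (nat \<Rightarrow> nat) \<Rightarrow> bool"
    \<comment> \<open>Each coordinate gives its larger value to the first end if it lies in
      \<open>D\<close> and to the second end otherwise. At \<open>j\<close>, which lies outside
      \<open>D\<close> in the application, both ends get the smaller value.\<close>
    define F where "F = (\<lambda>us :: nat list. {(D, j). D \<subseteq> {..<M} \<and> j < M \<and>
      \<chi> (\<lambda>i\<in>{..<M}. us ! (if i \<in> D then Suc (2 * i) else 2 * i))
        (\<lambda>i\<in>{..<M}. us ! (if i \<in> D \<or> i = j then 2 * i else Suc (2 * i)))})"
    have "\<forall>xs. F xs \<in> ?C" by (auto simp: F_def)
    from R[THEN spec, THEN mp, OF this] obtain ys \<Phi> where ys: "strict_sorted ys" "set ys \<subseteq> {..<R}"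
      "length ys = M * Suc W"
      and \<Phi>: "\<forall>xs. strict_sorted xs \<and> set xs \<subseteq> set ys \<and> length xs = 2 * M \<longrightarrow> F xs = \<Phi>"
      by (elim exE conjE) (rule that)
    \<comment> \<open>Coordinate \<open>i\<close> uses the \<open>i\<close>-th block of
      \<open>Suc W\<close> elements. The element at \<open>a = W\<close> is kept for filling up
      ties.\<close>
    define y where "y = (\<lambda>i a. ys ! (i * Suc W + a))"
    have bound: "i * Suc W + a < M * Suc W" if "i < M" "a < Suc W" for i a
    proof -
      have "i * Suc W + a < Suc i * Suc W" using that by simp
      also have "\<dots> \<le> M * Suc W" using that by (intro mult_le_mono1) simp
      finally show ?thesis .
    qed
    have y_less: "y i a < R" if "i < M" "a < W" for i a
      using bound[of i a] that ys by (auto simp: y_def intro!: nth_mem dest!: subsetD)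
    have y_inj: "inj_on (y i) {..<W}" if "i < M" for i
    proof (rule inj_onI)
      fix a b assume "a \<in> {..<W}" "b \<in> {..<W}" "y i a = y i b"
      moreover have "distinct ys" using ys strict_sorted_iff by auto
      ultimately show "a = b"
        using bound[of i a] bound[of i b] that ys by (simp add: y_def nth_eq_iff_index_eq)
    qed
    have colour: "\<chi> (\<lambda>i\<in>{..<M}. y i (z i)) (\<lambda>i\<in>{..<M}. y i (z' i))
          = (({i. i < M \<and> z' i < z i}, j) \<in> \<Phi>)"
      if z: "\<And>i. z i < W" "\<And>i. z' i < W" and "j < M" and tie: "{i. i < M \<and> z i = z' i} = {j}"
      for z z' j
    proof -
      \<comment> \<open>Coordinate \<open>i\<close> occupies the positions \<open>2 * i\<close> and \<open>2 * i + 1\<close> of \<open>us\<close>; in case of a tie, the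
        reserved value \<open>W\<close> keeps the list strictly sorted.\<close>
      define pos where "pos = (\<lambda>k. k div 2 * Suc W +
        (if even k then min (z (k div 2)) (z' (k div 2))
         else if z (k div 2) = z' (k div 2) then W else max (z (k div 2)) (z' (k div 2))))"
      define us where "us = map (\<lambda>k. ys ! pos k) [0..<2 * M]"
      define D where "D = {i. i < M \<and> z' i < z i}"
      have step: "pos k < pos (Suc k)" for k
      proof (cases "even k")
        case True
        then show ?thesis using z[of "k div 2"]
          by (auto simp: pos_def min_def max_def)
      next
        case False
        \<comment> \<open>The position after an odd one belongs to the next coordinate, hence to a
          later block.\<close>
        have "pos k < Suc (k div 2) * Suc W"
          using False z[of "k div 2"] by (auto simp: pos_def max_def less_Suc_eq)
        also have "Suc (k div 2) = Suc k div 2" using False by presburger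
        also have "Suc k div 2 * Suc W \<le> pos (Suc k)" by (simp add: pos_def)
        finally show ?thesis .
      qed
      hence mono: "k < l \<Longrightarrow> pos k < pos l" for k l
        by (rule lift_Suc_mono_less)
      have pos: "pos k < length ys" if "k < 2 * M" for k
      proof -
        have "k div 2 < M" using that by auto
        then show ?thesis using z[of "k div 2"] unfolding ys pos_def
          by (intro bound) (auto simp: less_Suc_eq)
      qed
      have "strict_sorted us"
        using mono pos sorted_wrt_nth_less[OF ys(1)]
        by (auto simp: us_def sorted_wrt_iff_nth_less)
      moreover have "set us \<subseteq> set ys" using pos by (auto simp: us_def)
      moreover have "length us = 2 * M" by (simp add: us_def)
      ultimately have "F us = \<Phi>" using \<Phi> by blast
      have us: "us ! (2 * i) = y i (min (z i) (z' i))"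
        "us ! Suc (2 * i) = y i (if z i = z' i then W else max (z i) (z' i))" if "i < M" for i
        using that by (simp_all add: us_def y_def pos_def)
      have s: "(\<lambda>i\<in>{..<M}. y i (z i))
          = (\<lambda>i\<in>{..<M}. us ! (if i \<in> D then Suc (2 * i) else 2 * i))"
        by (intro restrict_ext) (auto simp: us D_def min_def max_def)
      have "i = j \<longleftrightarrow> z i = z' i" if "i < M" for i using tie that by blast
      hence t: "(\<lambda>i\<in>{..<M}. y i (z' i))
          = (\<lambda>i\<in>{..<M}. us ! (if i \<in> D \<or> i = j then 2 * i else Suc (2 * i)))"
        by (intro restrict_ext) (auto simp: us D_def min_def max_def)
      have "D \<subseteq> {..<M}" by (auto simp: D_def)
      then show ?thesis
        using \<open>F us = \<Phi>\<close>[symmetric] \<open>j < M\<close> unfolding s t D_def[symmetric] by (simp add: F_def)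
    qed
    show "\<exists>y \<Phi>. (\<forall>i<M. \<forall>a<W. y i a < R) \<and> (\<forall>i<M. inj_on (y i) {..<W}) \<and>
     (\<forall>z z' j. (\<forall>i. z i < W \<and> z' i < W) \<and> j < M \<and> {i. i < M \<and> z i = z' i} = {j} \<longrightarrow>
        \<chi> (\<lambda>i\<in>{..<M}. y i (z i)) (\<lambda>i\<in>{..<M}. y i (z' i))
          = (({i. i < M \<and> z' i < z i}, j) \<in> \<Phi>))"
      by (intro exI[of _ y] exI[of _ \<Phi>] conjI allI impI; (elim conjE)?)
        (simp_all only: y_less y_inj colour)
  qed
qed

text \<open>Ramsey's theorem for \<open>L\<close>-element sets of coordinates. The colour of such a
  set is the set of ranks \<open>k\<close> at which \<open>\<Phi>\<close> holds when the element of
  rank \<open>k\<close> is taken as the tie and the others as the inverted coordinates.\<close>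

lemma colour_by_rank:
  "\<exists>M. \<forall>\<Phi> :: (nat set \<times> nat) set. \<exists>(js :: nat list) \<Psi>.
     strict_sorted js \<and> set js \<subseteq> {..<M} \<and> length js = B \<and>
     (\<forall>qs k. strict_sorted qs \<and> set qs \<subseteq> set js \<and> length qs = L \<and> k < L \<longrightarrow>
        ((set qs - {qs ! k}, qs ! k) \<in> \<Phi>) = (k \<in> \<Psi>))"
proof -
  have "finite (Pow {..<L})" by simp
  from ramsey_lists[OF this, where q = B and r = L]
  obtain M :: nat where M: "\<forall>F. (\<forall>xs. F xs \<in> Pow {..<L}) \<longrightarrow>
    (\<exists>js \<Psi>. strict_sorted js \<and> set js \<subseteq> {..<M} \<and> length js = B \<and> \<Psi> \<in> Pow {..<L} \<and>
      (\<forall>xs. strict_sorted xs \<and> set xs \<subseteq> set js \<and> length xs = L \<longrightarrow> F xs = \<Psi>))"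
    by (elim exE) (rule that)
  show ?thesis
  proof (intro exI[of _ M] allI)
    fix \<Phi> :: "(nat set \<times> nat) set"
    define F where "F = (\<lambda>qs :: nat list. {k. k < L \<and> (set qs - {qs ! k}, qs ! k) \<in> \<Phi>})"
    have "\<forall>xs. F xs \<in> Pow {..<L}" by (auto simp: F_def)
    from M[THEN spec, THEN mp, OF this] obtain js \<Psi> where js: "strict_sorted js" "set js \<subseteq> {..<M}" "length js = B"
      and \<Psi>: "\<forall>qs. strict_sorted qs \<and> set qs \<subseteq> set js \<and> length qs = L \<longrightarrow> F qs = \<Psi>"
      by (elim exE conjE) (rule that)
    have "((set qs - {qs ! k}, qs ! k) \<in> \<Phi>) = (k \<in> \<Psi>)"
      if "strict_sorted qs" "set qs \<subseteq> set js" "length qs = L" "k < L" for qs k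
    proof -
      have "F qs = \<Psi>" using \<Psi> that by blast
      then show ?thesis using that(4) by (auto simp: F_def)
    qed
    then show "\<exists>js \<Psi>. strict_sorted js \<and> set js \<subseteq> {..<M} \<and> length js = B \<and>
     (\<forall>qs k. strict_sorted qs \<and> set qs \<subseteq> set js \<and> length qs = L \<and> k < L \<longrightarrow>
        ((set qs - {qs ! k}, qs ! k) \<in> \<Phi>) = (k \<in> \<Psi>))"
      using js by blast
  qed
qed

section \<open>Vertices with prescribed ties\<close>

text \<open>\<open>\<Psi>\<close> is chosen before \<open>P\<close> and \<open>Q\<close>, so that
  the pairs can afterwards be placed at ranks of one colour. Degenerate pairs
  \<open>P g = Q g\<close> can fill the ranks that remain.\<close>

lemma tie_system:
  fixes n L :: nat
  assumes "L > 0"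
  shows "\<exists>M R. \<forall>\<chi> :: (nat \<Rightarrow> nat) \<Rightarrow> (nat \<Rightarrow> nat) \<Rightarrow> bool. \<exists>\<Psi>. \<forall>P Q.
    (\<forall>g<L. P g \<le> Q g \<and> Q g < n) \<longrightarrow>
    (\<exists>s J. s ` {..<n} \<subseteq> {..<M} \<rightarrow>\<^sub>E {..<R} \<and> inj_on s {..<n} \<and> strict_mono_on {..<L} J \<and>
       (\<forall>g<L. P g < Q g \<and> (\<forall>g'<L. g' \<noteq> g \<longrightarrow> (P g', Q g') \<noteq> (P g, Q g)) \<longrightarrow>
          \<chi> (s (P g)) (s (Q g)) = (g \<in> \<Psi>) \<and>
          {i. i < M \<and> s (P g) i = s (Q g) i} = {J g}))"
proof -
  \<comment> \<open>The values on the odd coordinates of the pairs go up to at most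
    \<open>2 * n + 1\<close>.\<close>
  define W where "W = 2 * n + 2"
  obtain M :: nat where M: "\<forall>\<Phi> :: (nat set \<times> nat) set. \<exists>(js :: nat list) \<Psi>.
     strict_sorted js \<and> set js \<subseteq> {..<M} \<and> length js = 2 * L \<and>
     (\<forall>qs k. strict_sorted qs \<and> set qs \<subseteq> set js \<and> length qs = L \<and> k < L \<longrightarrow>
        ((set qs - {qs ! k}, qs ! k) \<in> \<Phi>) = (k \<in> \<Psi>))"
    using colour_by_rank[where B = "2 * L" and L = L] by (elim exE) (rule that)
  obtain R :: nat where R: "\<forall>\<chi> :: (nat \<Rightarrow> nat) \<Rightarrow> (nat \<Rightarrow> nat) \<Rightarrow> bool.
    \<exists>(y :: nat \<Rightarrow> nat \<Rightarrow> nat) \<Phi>.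
     (\<forall>i<M. \<forall>a<W. y i a < R) \<and> (\<forall>i<M. inj_on (y i) {..<W}) \<and>
     (\<forall>z z' j. (\<forall>i. z i < W \<and> z' i < W) \<and> j < M \<and> {i. i < M \<and> z i = z' i} = {j} \<longrightarrow>
        \<chi> (\<lambda>i\<in>{..<M}. y i (z i)) (\<lambda>i\<in>{..<M}. y i (z' i))
          = (({i. i < M \<and> z' i < z i}, j) \<in> \<Phi>))"
    using colour_by_comparison[where M = M and W = W] by (elim exE) (rule that)
  show ?thesis
  proof (rule exI[of _ M], rule exI[of _ R], rule allI)
    fix \<chi> :: "(nat \<Rightarrow> nat) \<Rightarrow> (nat \<Rightarrow> nat) \<Rightarrow> bool"
    obtain y \<Phi> where y_less: "\<forall>i<M. \<forall>a<W. y i a < R" and y_inj: "\<forall>i<M. inj_on (y i) {..<W}"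
      and \<Phi>: "\<forall>z z' j. (\<forall>i. z i < W \<and> z' i < W) \<and> j < M \<and> {i. i < M \<and> z i = z' i} = {j} \<longrightarrow>
        \<chi> (\<lambda>i\<in>{..<M}. y i (z i)) (\<lambda>i\<in>{..<M}. y i (z' i))
          = (({i. i < M \<and> z' i < z i}, j) \<in> \<Phi>)"
      using R[THEN spec, of \<chi>] by (elim exE conjE) (rule that)
    obtain js :: "nat list" and \<Psi> where js: "strict_sorted js" "set js \<subseteq> {..<M}" "length js = 2 * L"
      and \<Psi>: "\<forall>qs k. strict_sorted qs \<and> set qs \<subseteq> set js \<and> length qs = L \<and> k < L \<longrightarrow>
        ((set qs - {qs ! k}, qs ! k) \<in> \<Phi>) = (k \<in> \<Psi>)"
      using M[THEN spec, of \<Phi>] by (elim exE conjE) (rule that)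
    have js_less: "js ! k < js ! l" if "k < l" "l < 2 * L" for k l
      using sorted_wrt_nth_less[OF js(1)] that js(3) by simp
    have js_inj: "inj_on ((!) js) {..<2 * L}"
      using js strict_sorted_iff by (intro inj_on_nth) auto
    have js_M: "js ! k < M" if "k < 2 * L" for k
      by (metis js(2,3) lessThan_iff nth_mem subsetD that)
    have set_js: "set js = (!) js ` {..<2 * L}"
      using js(3) by (auto simp: set_conv_nth)
    show "\<exists>\<Psi>. \<forall>P Q. (\<forall>g<L. P g \<le> Q g \<and> Q g < n) \<longrightarrow>
    (\<exists>s J. s ` {..<n} \<subseteq> {..<M} \<rightarrow>\<^sub>E {..<R} \<and> inj_on s {..<n} \<and> strict_mono_on {..<L} J \<and>
       (\<forall>g<L. P g < Q g \<and> (\<forall>g'<L. g' \<noteq> g \<longrightarrow> (P g', Q g') \<noteq> (P g, Q g)) \<longrightarrow>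
          \<chi> (s (P g)) (s (Q g)) = (g \<in> \<Psi>) \<and>
          {i. i < M \<and> s (P g) i = s (Q g) i} = {J g}))"
    proof (intro exI[of _ \<Psi>] allI impI)
      fix P Q :: "nat \<Rightarrow> nat" assume PQ: "\<forall>g<L. P g \<le> Q g \<and> Q g < n"
      \<comment> \<open>Merging \<open>P g\<close> into \<open>Q g\<close> creates the tie. The odd coordinate reverses this order, and the
        summand 1 places \<open>Q g\<close> just above \<open>P g\<close>.\<close>
      define \<sigma> where "\<sigma> = (\<lambda>g v. if v = P g then Q g else v)"
      define \<tau> where "\<tau> = (\<lambda>k v. if even k then \<sigma> (k div 2) v
        else 2 * n - 2 * \<sigma> (k div 2) v + (if v = Q (k div 2) then 1 else 0))"
      \<comment> \<open>Coordinates outside \<open>js\<close> carry the vertex itself, so there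
        \<open>v < w\<close> gives neither a tie nor an inversion.\<close>
      define z where "z = (\<lambda>v i. if i \<in> set js then \<tau> (inv_into {..<2 * L} ((!) js) i) v else v)"
      define s where "s = (\<lambda>v. \<lambda>i\<in>{..<M}. y i (z v i))"
      define J where "J = (\<lambda>g. js ! (2 * g))"
      have z_js: "z v (js ! k) = \<tau> k v" if "k < 2 * L" for v k
        using that js(3) by (simp add: z_def inv_into_f_f[OF js_inj])
      have \<sigma>_less: "\<sigma> g v < n" if "g < L" "v < n" for g v
        using PQ that by (auto simp: \<sigma>_def)
      have z_less: "z v i < W" if "v < n" for v i
      proof (cases "i \<in> set js")
        case True
        then obtain k where k: "k < 2 * L" "i = js ! k" using set_js by auto
        hence "k div 2 < L" by auto
        with k show ?thesis using \<sigma>_less[OF _ that, of "k div 2"] by (auto simp: z_js \<tau>_def W_def)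
      next
        case False
        then show ?thesis using that by (simp add: z_def W_def)
      qed
      have s_eq: "s v i = s w i \<longleftrightarrow> z v i = z w i" if "i < M" "v < n" "w < n" for v w i
        using y_inj[rule_format, OF that(1)] that z_less by (auto simp: s_def dest!: inj_onD)
      have "s ` {..<n} \<subseteq> {..<M} \<rightarrow>\<^sub>E {..<R}"
        using y_less z_less by (auto simp: s_def split: if_splits)
      \<comment> \<open>The odd coordinate of pair 0 alone separates the vertices: its parity
        singles out \<open>Q 0\<close>, and \<open>\<sigma> 0\<close> is injective on the
        rest.\<close>
      moreover have "inj_on s {..<n}"
      proof (rule inj_onI)
        fix v w assume vw: "v \<in> {..<n}" "w \<in> {..<n}" "s v = s w"
        hence "z v (js ! 1) = z w (js ! 1)"
          using s_eq[of "js ! 1" v w] js_M[of 1] \<open>L > 0\<close> by simp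
        hence "\<tau> 1 v = \<tau> 1 w" using z_js[of 1] \<open>L > 0\<close> by simp
        with vw PQ \<open>L > 0\<close> show "v = w" by (simp add: \<tau>_def \<sigma>_def split: if_splits)
      qed
      moreover have "strict_mono_on {..<L} J"
        by (auto simp: J_def intro!: strict_mono_onI js_less)
      moreover have "\<chi> (s (P g)) (s (Q g)) = (g \<in> \<Psi>) \<and> {i. i < M \<and> s (P g) i = s (Q g) i} = {J g}"
        if g: "g < L" "P g < Q g" and uniq: "\<forall>g'<L. g' \<noteq> g \<longrightarrow> (P g', Q g') \<noteq> (P g, Q g)" for g
      proof -
        define v w where "v = P g" and "w = Q g"
        have vw: "v < w" "w < n" "v < n" using g PQ by (auto simp: v_def w_def dest: spec[of _ g])
        have tie: "\<tau> (2 * g) v = \<tau> (2 * g) w" "\<tau> (Suc (2 * g)) v < \<tau> (Suc (2 * g)) w"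
          using g vw by (auto simp: \<tau>_def \<sigma>_def v_def w_def)
        \<comment> \<open>\<open>\<sigma> h\<close> identifies at most \<open>P h\<close> and
          \<open>Q h\<close>, and this pair is not \<open>(v, w)\<close> by \<open>uniq\<close>. On
          the odd coordinate the doubled gap outweighs the summand 1, so the order is strictly
          reversed and exactly one of the two coordinates is inverted.\<close>
        have other: "\<tau> (2 * h) v \<noteq> \<tau> (2 * h) w \<and> \<tau> (Suc (2 * h)) v \<noteq> \<tau> (Suc (2 * h)) w \<and>
          (\<tau> (2 * h) w < \<tau> (2 * h) v \<longleftrightarrow> \<not> \<tau> (Suc (2 * h)) w < \<tau> (Suc (2 * h)) v)"
          if "h < L" "h \<noteq> g" for h
        proof -
          have "\<sigma> h v \<noteq> \<sigma> h w"
            using uniq that vw PQ[rule_format, OF \<open>h < L\<close>] by (auto simp: \<sigma>_def v_def w_def)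
          moreover have "\<sigma> h v < n" "\<sigma> h w < n" using that vw by (auto intro: \<sigma>_less)
          ultimately show ?thesis by (auto simp: \<tau>_def)
        qed
        \<comment> \<open>From each pair of coordinates this selects the inverted one, and the tied
          one for \<open>g\<close>. The pairs are consecutive in \<open>js\<close>, so the selection
          is increasing and the tie has rank \<open>g\<close>.\<close>
        define \<epsilon> where "\<epsilon> = (\<lambda>h. if \<tau> (2 * h) w < \<tau> (2 * h) v \<or> h = g then 2 * h else Suc (2 * h))"
        define qs where "qs = map (\<lambda>h. js ! \<epsilon> h) [0..<L]"
        have \<epsilon>_less: "\<epsilon> h < 2 * L" if "h < L" for h using that by (auto simp: \<epsilon>_def)
        have \<epsilon>_mono: "\<epsilon> h < \<epsilon> h'" if "h < h'" for h h' using that by (auto simp: \<epsilon>_def)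
        have "strict_sorted qs"
          by (auto simp: qs_def sorted_wrt_iff_nth_less intro!: js_less \<epsilon>_mono \<epsilon>_less)
        moreover have "set qs \<subseteq> set js" using \<epsilon>_less by (auto simp: qs_def set_js)
        moreover have "length qs = L" by (simp add: qs_def)
        ultimately have "((set qs - {qs ! g}, qs ! g) \<in> \<Phi>) = (g \<in> \<Psi>)" using \<Psi> g by blast
        moreover have qs_g: "qs ! g = J g" using g by (simp add: qs_def \<epsilon>_def J_def)
        moreover have ties: "{i. i < M \<and> z v i = z w i} = {J g}"
        proof (intro set_eqI iffI)
          fix i assume i: "i \<in> {i. i < M \<and> z v i = z w i}"
          hence "i \<in> set js" using vw by (auto simp: z_def split: if_splits)
          then obtain k where k: "k < 2 * L" "i = js ! k" using set_js by auto
          hence eq: "\<tau> k v = \<tau> k w" using i by (simp add: z_js)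
          define h where "h = k div 2"
          have "h < L" "k = 2 * h \<or> k = Suc (2 * h)" using k by (auto simp: h_def)
          hence "k = 2 * g" using eq tie other[of h] by (cases "h = g") auto
          thus "i \<in> {J g}" using k by (simp add: J_def)
        next
          fix i assume "i \<in> {J g}"
          thus "i \<in> {i. i < M \<and> z v i = z w i}"
            using g tie js_M z_js by (simp add: J_def)
        qed
        moreover have "set qs - {qs ! g} = {i. i < M \<and> z w i < z v i}"
        proof (intro set_eqI iffI)
          fix i assume i: "i \<in> set qs - {qs ! g}"
          then obtain h where h: "h < L" "i = js ! \<epsilon> h" by (auto simp: qs_def)
          moreover have "h \<noteq> g" using i h by (auto simp: qs_def)
          ultimately show "i \<in> {i. i < M \<and> z w i < z v i}"
            using other[of h] \<epsilon>_less[OF h(1)] by (auto simp: js_M z_js \<epsilon>_def)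
        next
          fix i assume i: "i \<in> {i. i < M \<and> z w i < z v i}"
          hence "i \<in> set js" using vw by (auto simp: z_def split: if_splits)
          then obtain k where k: "k < 2 * L" "i = js ! k" using set_js by auto
          hence inv: "\<tau> k w < \<tau> k v" using i by (simp add: z_js)
          define h where "h = k div 2"
          have h: "h < L" "k = 2 * h \<or> k = Suc (2 * h)" using k by (auto simp: h_def)
          have "h \<noteq> g" using inv tie h by auto
          hence "k = \<epsilon> h" using inv h other[of h] by (auto simp: \<epsilon>_def)
          hence "i \<in> set qs" using h k by (auto simp: qs_def)
          moreover have "z v (J g) = z w (J g)" using ties by blast
          hence "i \<noteq> J g" using i by auto
          ultimately show "i \<in> set qs - {qs ! g}" using qs_g by simp
        qed
        moreover have "J g < M" using g js_M by (simp add: J_def)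
        \<comment> \<open>\<open>\<Phi>\<close> reduces the colour to the inversions and the tie,
          and \<open>\<Psi>\<close> reduces these to the rank \<open>g\<close>.\<close>
        ultimately have "\<chi> (s v) (s w) = (g \<in> \<Psi>)"
          using \<Phi>[rule_format, of "z v" "z w" "J g"] z_less vw by (simp add: s_def)
        moreover have "{i. i < M \<and> s v i = s w i} = {i. i < M \<and> z v i = z w i}"
          using s_eq vw by (intro Collect_cong) blast
        ultimately show ?thesis unfolding v_def[symmetric] w_def[symmetric] using ties by simp
      qed
      ultimately show "\<exists>s J. s ` {..<n} \<subseteq> {..<M} \<rightarrow>\<^sub>E {..<R} \<and> inj_on s {..<n} \<and>
        strict_mono_on {..<L} J \<and>
       (\<forall>g<L. P g < Q g \<and> (\<forall>g'<L. g' \<noteq> g \<longrightarrow> (P g', Q g') \<noteq> (P g, Q g)) \<longrightarrow>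
          \<chi> (s (P g)) (s (Q g)) = (g \<in> \<Psi>) \<and>
          {i. i < M \<and> s (P g) i = s (Q g) i} = {J g})"
        by (intro exI[of _ s] exI[of _ J] conjI allI impI; (elim conjE)?) simp_all
    qed
  qed
qed

section \<open>Pigeonhole principle and linear orders\<close>

text \<open>\<open>\<Psi>\<close> or its complement contains at least \<open>m\<close> of the
  \<open>2 * m + 1\<close> ranks. Enumerating \<open>m\<close> of them increasingly lets them carry
  the edge order.\<close>

lemma strict_mono_pigeonhole:
  obtains \<gamma> :: "nat \<Rightarrow> nat" where "strict_mono_on {..<m} \<gamma>" "\<gamma> ` {..<m} \<subseteq> {..<2 * m + 1}"
    "\<gamma> ` {..<m} \<subseteq> \<Psi> \<or> \<gamma> ` {..<m} \<inter> \<Psi> = {}"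
proof -
  have "card ({..<2 * m + 1} \<inter> \<Psi>) + card ({..<2 * m + 1} - \<Psi>) = 2 * m + 1"
    by (subst card_Un_disjoint[symmetric]) (auto simp: Int_Diff_Un)
  hence "m \<le> card ({..<2 * m + 1} \<inter> \<Psi>) \<or> m \<le> card ({..<2 * m + 1} - \<Psi>)"
    by linarith
  then obtain A where A: "A = {..<2 * m + 1} \<inter> \<Psi> \<or> A = {..<2 * m + 1} - \<Psi>" "m \<le> card A"
    by blast
  then obtain B where B: "B \<subseteq> A" "card B = m" "finite B"
    using obtain_subset_with_card_n by metis
  obtain \<gamma> where "bij_betw \<gamma> {..<card B} B" "strict_mono_on {..<card B} \<gamma>"
    using ex_bij_betw_strict_mono_card[OF B(3)] by metis
  with B A show thesis by (intro that[of \<gamma>]) (auto simp: bij_betw_def)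
qed

lemma strict_linear_order_on_subset:
  assumes "strict_linear_order_on A r" "B \<subseteq> A"
  shows "strict_linear_order_on B (r \<inter> B \<times> B)"
  using assms unfolding strict_linear_order_on_def
  by (auto simp: irrefl_def total_on_def trans_Restr)

text \<open>Equal labels are separated by an injection into the naturals. The edges of the copy to
  be found get distinct labels, so any refinement serves.\<close>

lemma strict_linear_order_refining:
  fixes l :: "'a \<Rightarrow> nat"
  assumes "finite A"
  obtains r where "r \<subseteq> A \<times> A" "strict_linear_order_on A r"
    "\<And>x y. x \<in> A \<Longrightarrow> y \<in> A \<Longrightarrow> l x < l y \<Longrightarrow> (x, y) \<in> r"
proof -
  obtain \<iota> :: "'a \<Rightarrow> nat" where \<iota>: "inj_on \<iota> A"
    using finite_imp_inj_to_nat_seg[OF assms] by blast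
  define r where "r = {(x, y). x \<in> A \<and> y \<in> A \<and> (l x < l y \<or> l x = l y \<and> \<iota> x < \<iota> y)}"
  show thesis
  proof (rule that[of r])
    show "strict_linear_order_on A r"
      unfolding strict_linear_order_on_def
    proof (intro conjI)
      show "trans r" by (rule transI) (auto simp: r_def)
      show "irrefl r" by (auto simp: r_def irrefl_def)
      show "total_on A r"
      proof (rule total_onI)
        fix x y assume "x \<in> A" "y \<in> A" "x \<noteq> y"
        moreover from this have "\<iota> x \<noteq> \<iota> y" using \<iota> by (auto dest: inj_onD)
        ultimately show "(x, y) \<in> r \<or> (y, x) \<in> r" by (auto simp: r_def)
      qed
    qed
  qed (auto simp: r_def)
qed

text \<open>The rank counts predecessors; transitivity and irreflexivity make it increase strictly
  along \<open>r\<close>.\<close>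

lemma strict_linear_order_rank:
  assumes "finite A" "r \<subseteq> A \<times> A" "strict_linear_order_on A r"
  obtains \<rho> :: "'a \<Rightarrow> nat" where "inj_on \<rho> A" "\<rho> ` A \<subseteq> {..<card A}"
    "\<And>x y. (x, y) \<in> r \<Longrightarrow> \<rho> x < \<rho> y"
proof -
  define \<rho> where "\<rho> = (\<lambda>x. card {y \<in> A. (y, x) \<in> r})"
  have r: "trans r" "irrefl r" "total_on A r"
    using assms(3) by (auto simp: strict_linear_order_on_def)
  have less: "\<rho> x < \<rho> y" if "(x, y) \<in> r" for x y
    unfolding \<rho>_def
  proof (rule psubset_card_mono)
    show "{z \<in> A. (z, x) \<in> r} \<subset> {z \<in> A. (z, y) \<in> r}"
      using that r assms(2) by (auto simp: irrefl_def dest: transD)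
  qed (use assms in auto)
  moreover have "\<rho> x < card A" if "x \<in> A" for x
    unfolding \<rho>_def using that r assms(1)
    by (intro psubset_card_mono) (auto simp: irrefl_def)
  moreover have "inj_on \<rho> A"
    using r(3) less by (intro inj_onI) (metis less_irrefl total_on_def)
  ultimately show thesis by (intro that[of \<rho>]) auto
qed

section \<open>Copies given by vertex maps\<close>

text \<open>The converse of \<open>mono\<close> on edges follows because \<open>eord G\<close> is
  total while \<open>eord K\<close> is transitive and irreflexive.\<close>

lemma eo_copy_image:
  assumes G: "edge_ordered_graph G" and K: "edge_ordered_graph K"
    and f: "inj_on f (verts G)" "f ` verts G \<subseteq> verts K" "(`) f ` edges G \<subseteq> edges K"
    and mono: "\<And>e e'. (e, e') \<in> eord G \<Longrightarrow> (f ` e, f ` e') \<in> eord K"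
  defines "E \<equiv> (`) f ` edges G"
  shows "eo_copy G (EOGraph (f ` verts G) E (eord K \<inter> E \<times> E)) K"
proof -
  have sub: "e \<subseteq> verts G" if "e \<in> edges G" for e
    using G that by (auto simp: edge_ordered_graph_def nsets_def)
  have "E \<subseteq> [f ` verts G]\<^bsup>2\<^esup>"
  proof
    fix x assume "x \<in> E"
    then obtain e where e: "e \<in> edges G" "x = f ` e" by (auto simp: E_def)
    hence "card x = 2" using G sub[OF e(1)] f(1)
      by (subst e) (auto simp: card_image edge_ordered_graph_def nsets_def inj_on_subset)
    moreover have "finite e" using G e by (auto simp: edge_ordered_graph_def nsets_def)
    ultimately show "x \<in> [f ` verts G]\<^bsup>2\<^esup>" using sub[OF e(1)] e(2) by (auto simp: nsets_def)
  qed
  moreover have "strict_linear_order_on E (eord K \<inter> E \<times> E)"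
    using K f(3) by (intro strict_linear_order_on_subset[of "edges K"])
      (auto simp: edge_ordered_graph_def E_def)
  ultimately have "eo_subgraph (EOGraph (f ` verts G) E (eord K \<inter> E \<times> E)) K"
    using G K f(2,3) by (auto simp: eo_subgraph_def edge_ordered_graph_def E_def)
  moreover have "eo_isomorphic G (EOGraph (f ` verts G) E (eord K \<inter> E \<times> E))"
    unfolding eo_isomorphic_def
  proof (intro exI[of _ f] conjI ballI)
    show "bij_betw f (verts G) (verts (EOGraph (f ` verts G) E (eord K \<inter> E \<times> E)))"
      using f(1) by (simp add: bij_betw_def)
  next
    fix u v assume uv: "u \<in> verts G" "v \<in> verts G"
    have "{u, v} \<in> edges G" if e: "e \<in> edges G" "f ` {u, v} = f ` e" for e
      using inj_on_image_eq_iff[OF f(1), of "{u, v}" e] uv e sub by auto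
    hence "f ` {u, v} \<in> E \<longleftrightarrow> {u, v} \<in> edges G" unfolding E_def by blast
    then show "{u, v} \<in> edges G \<longleftrightarrow>
        {f u, f v} \<in> edges (EOGraph (f ` verts G) E (eord K \<inter> E \<times> E))"
      by simp
  next
    fix e e' assume e: "e \<in> edges G" "e' \<in> edges G"
    have tot: "total_on (edges G) (eord G)" and K': "trans (eord K)" "irrefl (eord K)"
      using G K by (auto simp: edge_ordered_graph_def strict_linear_order_on_def)
    have "(e, e') \<in> eord G" if "(f ` e, f ` e') \<in> eord K"
    proof (rule ccontr)
      assume "(e, e') \<notin> eord G"
      hence "e = e' \<or> (e', e) \<in> eord G" using tot e by (auto simp: total_on_def)
      thus False using that mono[of e' e] K' by (auto simp: irrefl_def dest: transD)
    qed
    then show "(e, e') \<in> eord G \<longleftrightarrow>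
        (f ` e, f ` e') \<in> eord (EOGraph (f ` verts G) E (eord K \<inter> E \<times> E))"
      using e mono by (auto simp: E_def)
  qed
  ultimately show ?thesis by (simp add: eo_copy_def)
qed

section \<open>The edge-ordering and the monochromatic copy\<close>

lemma edge_ordered_arrowing:
  fixes G :: "'a eograph"
  assumes G: "edge_ordered_graph G"
  shows "\<exists>N>0. \<exists>K. edge_ordering_of_complete N K \<and> eo_arrows K G"
proof -
  have fin: "finite (verts G)" and edges: "edges G \<subseteq> [verts G]\<^bsup>2\<^esup>"
    using G by (auto simp: edge_ordered_graph_def)
  have finE: "finite (edges G)"
    using fin edges finite_imp_finite_nsets finite_subset by metis
  define m where "m = card (edges G)"
  \<comment> \<open>The summand 1 keeps \<open>L\<close> positive for a graph without edges.\<close>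
  define L where "L = 2 * m + 1"
  hence "L > 0" by simp
  \<comment> \<open>\<open>Suc\<close> leaves room for the filler end 0 even when \<open>G\<close>
    has no vertices.\<close>
  define n where "n = Suc (card (verts G))"
  obtain h where h: "bij_betw h (verts G) {0..<card (verts G)}"
    using ex_bij_betw_finite_nat[OF fin] by blast
  have h_inj: "inj_on h (verts G)" and h_less: "\<And>a. a \<in> verts G \<Longrightarrow> h a < n"
    using h by (auto simp: bij_betw_def n_def less_Suc_eq)
  obtain \<rho> where \<rho>: "inj_on \<rho> (edges G)" "\<rho> ` edges G \<subseteq> {..<m}"
    "\<And>e e'. (e, e') \<in> eord G \<Longrightarrow> \<rho> e < \<rho> e'"
    using strict_linear_order_rank[OF finE, of "eord G"] G
    by (metis edge_ordered_graph_def m_def)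
  obtain M R where MR: "\<forall>\<chi> :: (nat \<Rightarrow> nat) \<Rightarrow> (nat \<Rightarrow> nat) \<Rightarrow> bool. \<exists>\<Psi>. \<forall>P Q.
    (\<forall>g<L. P g \<le> Q g \<and> Q g < n) \<longrightarrow>
    (\<exists>s J. s ` {..<n} \<subseteq> {..<M} \<rightarrow>\<^sub>E {..<R} \<and> inj_on s {..<n} \<and> strict_mono_on {..<L} J \<and>
       (\<forall>g<L. P g < Q g \<and> (\<forall>g'<L. g' \<noteq> g \<longrightarrow> (P g', Q g') \<noteq> (P g, Q g)) \<longrightarrow>
          \<chi> (s (P g)) (s (Q g)) = (g \<in> \<Psi>) \<and>
          {i. i < M \<and> s (P g) i = s (Q g) i} = {J g}))"
    using tie_system[OF \<open>L > 0\<close>, of n] by (elim exE) (rule that)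
  \<comment> \<open>\<open>Suc R\<close> keeps \<open>V\<close> nonempty, and so \<open>N\<close>
    positive, even if \<open>R = 0\<close>.\<close>
  define V where "V = {..<M} \<rightarrow>\<^sub>E {..<Suc R}"
  define N where "N = card V"
  have "finite V" by (auto simp: V_def intro: finite_PiE)
  have "V \<noteq> {}" by (auto simp: V_def PiE_eq_empty_iff)
  hence "N > 0" using \<open>finite V\<close> by (auto simp: N_def)
  obtain \<beta> where \<beta>: "bij_betw \<beta> V {0..<N}"
    using ex_bij_betw_finite_nat[OF \<open>finite V\<close>] by (auto simp: N_def)
  \<comment> \<open>For edges of the complete graph the minimum exists and is at most
    \<open>M\<close>: functions in \<open>V\<close> take the same default value from
    \<open>M\<close> on.\<close>
  define lab where "lab = (\<lambda>e. LEAST i. \<forall>a\<in>e. \<forall>b\<in>e. inv_into V \<beta> a i = inv_into V \<beta> b i)"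
  have "finite ([{..<N}]\<^bsup>2\<^esup>)" by (simp add: finite_imp_finite_nsets)
  from strict_linear_order_refining[OF this, of lab]
  obtain r where r: "r \<subseteq> [{..<N}]\<^bsup>2\<^esup> \<times> [{..<N}]\<^bsup>2\<^esup>" "strict_linear_order_on ([{..<N}]\<^bsup>2\<^esup>) r"
    "\<And>e e'. e \<in> [{..<N}]\<^bsup>2\<^esup> \<Longrightarrow> e' \<in> [{..<N}]\<^bsup>2\<^esup> \<Longrightarrow> lab e < lab e' \<Longrightarrow> (e, e') \<in> r"
    by metis
  define K where "K = EOGraph {..<N} ([{..<N}]\<^bsup>2\<^esup>) r"
  have K: "edge_ordering_of_complete N K"
    using r by (simp add: K_def edge_ordering_of_complete_def edge_ordered_graph_def)
  moreover have "eo_arrows K G"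
    unfolding eo_arrows_def
  proof (intro allI impI)
    fix c assume c: "edge_coloring 2 K c"
    \<comment> \<open>The predicate \<open>\<chi>\<close> says that the edge has colour 0, which
      determines one of two colours.\<close>
    obtain \<Psi> where \<Psi>: "\<forall>P Q.
    (\<forall>g<L. P g \<le> Q g \<and> Q g < n) \<longrightarrow>
    (\<exists>s J. s ` {..<n} \<subseteq> {..<M} \<rightarrow>\<^sub>E {..<R} \<and> inj_on s {..<n} \<and> strict_mono_on {..<L} J \<and>
       (\<forall>g<L. P g < Q g \<and> (\<forall>g'<L. g' \<noteq> g \<longrightarrow> (P g', Q g') \<noteq> (P g, Q g)) \<longrightarrow>
          (c {\<beta> (s (P g)), \<beta> (s (Q g))} = 0) = (g \<in> \<Psi>) \<and>
          {i. i < M \<and> s (P g) i = s (Q g) i} = {J g}))"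
      using MR[THEN spec, of "\<lambda>s t. c {\<beta> s, \<beta> t} = 0"] by (elim exE) (rule that)
    obtain \<gamma> where \<gamma>: "strict_mono_on {..<m} \<gamma>" "\<gamma> ` {..<m} \<subseteq> {..<L}"
      "\<gamma> ` {..<m} \<subseteq> \<Psi> \<or> \<gamma> ` {..<m} \<inter> \<Psi> = {}"
      unfolding L_def by (rule strict_mono_pigeonhole)
    \<comment> \<open>Edge \<open>e\<close> receives the selected rank with number
      \<open>\<rho> e\<close>. These ranks lie on one side of \<open>\<Psi>\<close> and increase
      with the edge order.\<close>
    define \<kappa> where "\<kappa> = \<gamma> \<circ> \<rho>"
    have \<kappa>_inj: "inj_on \<kappa> (edges G)"
      unfolding \<kappa>_def using \<rho>(1,2) \<gamma>(1)
      by (intro comp_inj_on) (auto intro: inj_on_subset strict_mono_on_imp_inj_on)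
    have \<kappa>_less: "\<kappa> e < L" and \<kappa>_\<gamma>: "\<kappa> e \<in> \<gamma> ` {..<m}" if "e \<in> edges G" for e
      using that \<rho>(2) \<gamma>(2) by (auto simp: \<kappa>_def)
    \<comment> \<open>Pairs of coordinates that belong to no edge get the degenerate ends \<open>{0}\<close>.\<close>
    define ends where "ends = (\<lambda>g. if g \<in> \<kappa> ` edges G then h ` inv_into (edges G) \<kappa> g else {0})"
    have ends_\<kappa>: "ends (\<kappa> e) = h ` e" if "e \<in> edges G" for e
      using that \<kappa>_inj by (simp add: ends_def)
    have ends: "finite (ends g) \<and> ends g \<noteq> {} \<and> ends g \<subseteq> {..<n}" for g
    proof (cases "g \<in> \<kappa> ` edges G")
      case True
      then obtain e where e: "e \<in> edges G" "g = \<kappa> e" by auto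
      hence "e \<subseteq> verts G" "finite e" "e \<noteq> {}" using edges by (auto simp: nsets_def)
      then show ?thesis using e h_less by (auto simp: ends_\<kappa>)
    next
      case False
      then show ?thesis by (simp add: ends_def n_def)
    qed
    define P Q where "P = (\<lambda>g. Min (ends g))" and "Q = (\<lambda>g. Max (ends g))"
    have "P g \<le> Q g \<and> Q g < n" for g
      using ends[of g] Max_in[of "ends g"] by (auto simp: P_def Q_def)
    hence "\<forall>g<L. P g \<le> Q g \<and> Q g < n" by blast
    from \<Psi>[THEN spec, THEN spec, THEN mp, OF this]
    obtain s J where s: "s ` {..<n} \<subseteq> {..<M} \<rightarrow>\<^sub>E {..<R}" "inj_on s {..<n}"
      and J: "strict_mono_on {..<L} J"
      and tie: "\<forall>g<L. P g < Q g \<and>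
         (\<forall>g'<L. g' \<noteq> g \<longrightarrow> (P g', Q g') \<noteq> (P g, Q g)) \<longrightarrow>
          (c {\<beta> (s (P g)), \<beta> (s (Q g))} = 0) = (g \<in> \<Psi>) \<and>
          {i. i < M \<and> s (P g) i = s (Q g) i} = {J g}"
      by (elim exE conjE) (rule that)
    define f where "f = \<beta> \<circ> s \<circ> h"
    have "s ` {..<n} \<subseteq> V" using s(1) by (auto simp: V_def PiE_iff image_subset_iff less_Suc_eq)
    hence sV: "s a \<in> V" if "a < n" for a using that by auto
    have f_inj: "inj_on f (verts G)"
      unfolding f_def using h_inj h_less s(2) \<beta> sV
      by (intro comp_inj_on) (auto simp: bij_betw_def intro: inj_on_subset)
    have f_verts: "f ` verts G \<subseteq> {..<N}"
      using \<beta> sV h_less by (auto simp: f_def bij_betw_def)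
    have edge: "f ` e \<in> [{..<N}]\<^bsup>2\<^esup> \<and> (c (f ` e) = 0) = (\<kappa> e \<in> \<Psi>) \<and> lab (f ` e) = J (\<kappa> e)"
      if e: "e \<in> edges G" for e
    proof -
      have "e \<in> [verts G]\<^bsup>2\<^esup>" using e edges by blast
      then obtain a0 b0 where "e = {a0, b0}" "a0 \<in> verts G" "b0 \<in> verts G" "a0 \<noteq> b0"
        by (auto elim: nsets2_E)
      then obtain a b where ab: "e = {a, b}" "a \<in> verts G" "b \<in> verts G" "h a < h b"
        using h_inj by (metis inj_onD insert_commute linorder_neqE_nat)
      have "h ` e = {h a, h b}" by (simp add: ab(1))
      hence PQ: "P (\<kappa> e) = h a" "Q (\<kappa> e) = h b"
        using ab(4) by (simp_all add: P_def Q_def ends_\<kappa>[OF e])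
      \<comment> \<open>Different edges have different ends because \<open>h\<close> is injective,
        and a filler has \<open>P g = Q g\<close> whereas \<open>h a < h b\<close>.\<close>
      have "(P g, Q g) \<noteq> (P (\<kappa> e), Q (\<kappa> e))" if "g \<noteq> \<kappa> e" for g
      proof (cases "g \<in> \<kappa> ` edges G")
        case True
        then obtain e' where e': "e' \<in> edges G" "g = \<kappa> e'" by auto
        hence "e' \<in> [verts G]\<^bsup>2\<^esup>" using edges by blast
        then obtain a' b' where ab': "e' = {a', b'}" "a' \<in> verts G" "b' \<in> verts G"
          by (auto elim: nsets2_E)
        have "h ` e' = {h a', h b'}" by (simp add: ab'(1))
        hence "{P g, Q g} = h ` e'"
          by (auto simp: P_def Q_def e'(2) ends_\<kappa>[OF e'(1)] min_def max_def)
        moreover have "h ` e' \<noteq> h ` e"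
          using inj_on_image_eq_iff[OF h_inj, of e' e] ab ab' e' that by auto
        ultimately show ?thesis using PQ ab by auto
      next
        case False
        then show ?thesis using PQ ab by (auto simp: P_def Q_def ends_def)
      qed
      hence *: "(c {\<beta> (s (h a)), \<beta> (s (h b))} = 0) = (\<kappa> e \<in> \<Psi>)"
          "{i. i < M \<and> s (h a) i = s (h b) i} = {J (\<kappa> e)}"
        using tie[rule_format, of "\<kappa> e"] \<kappa>_less[OF e] ab PQ by auto
      have fe: "f ` e = {\<beta> (s (h a)), \<beta> (s (h b))}" using ab by (simp add: f_def)
      have "f a \<noteq> f b" using f_inj ab by (auto dest: inj_onD)
      hence "f ` e \<in> [{..<N}]\<^bsup>2\<^esup>" using ab f_verts by auto
      moreover have "lab (f ` e) = J (\<kappa> e)"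
      proof -
        have inv: "inv_into V \<beta> (\<beta> (s (h v))) = s (h v)" if "v \<in> verts G" for v
          using \<beta> sV h_less that by (simp add: bij_betw_def)
        have "lab (f ` e) = (LEAST i. s (h a) i = s (h b) i)"
          unfolding lab_def fe using ab by (simp add: inv) metis
        also have "\<dots> = J (\<kappa> e)"
        proof (rule Least_equality)
          have J: "J (\<kappa> e) < M \<and> s (h a) (J (\<kappa> e)) = s (h b) (J (\<kappa> e))" using *(2) by blast
          then show "s (h a) (J (\<kappa> e)) = s (h b) (J (\<kappa> e))" by blast
          fix i assume "s (h a) i = s (h b) i"
          \<comment> \<open>An agreement before \<open>J (\<kappa> e)\<close> would be at a
            coordinate below \<open>M\<close> and hence a second tie.\<close>
          show "J (\<kappa> e) \<le> i"
          proof (rule ccontr)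
            assume "\<not> J (\<kappa> e) \<le> i"
            hence "i \<in> {i. i < M \<and> s (h a) i = s (h b) i}"
              using J \<open>s (h a) i = s (h b) i\<close> by simp
            thus False using *(2) \<open>\<not> J (\<kappa> e) \<le> i\<close> by simp
          qed
        qed
        finally show ?thesis .
      qed
      ultimately show ?thesis using *(1) fe by simp
    qed
    have mono: "(f ` e, f ` e') \<in> r" if "(e, e') \<in> eord G" for e e'
    proof -
      have e: "e \<in> edges G" "e' \<in> edges G" using that G by (auto simp: edge_ordered_graph_def)
      hence "\<rho> e \<in> {..<m}" "\<rho> e' \<in> {..<m}" using \<rho>(2) by auto
      hence "\<kappa> e < \<kappa> e'"
        using strict_mono_onD[OF \<gamma>(1)] \<rho>(3)[OF that] by (simp add: \<kappa>_def)
      hence "J (\<kappa> e) < J (\<kappa> e')"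
        using strict_mono_onD[OF J] \<kappa>_less e by simp
      then show ?thesis using edge[OF e(1)] edge[OF e(2)] by (intro r) simp_all
    qed
    define E where "E = (`) f ` edges G"
    have copy: "eo_copy G (EOGraph (f ` verts G) E (eord K \<inter> E \<times> E)) K"
      unfolding E_def
    proof (rule eo_copy_image[OF G _ f_inj])
      show "edge_ordered_graph K" using K by (simp add: edge_ordering_of_complete_def)
    qed (use f_verts edge mono in \<open>auto simp: K_def\<close>)
    have same: "c (f ` e) = c (f ` e')" if "e \<in> edges G" "e' \<in> edges G" for e e'
    proof -
      have "c (f ` e) < 2" "c (f ` e') < 2"
        using c edge[OF that(1)] edge[OF that(2)] by (auto simp: edge_coloring_def K_def)
      moreover have "\<kappa> e \<in> \<Psi> \<longleftrightarrow> \<kappa> e' \<in> \<Psi>"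
        using \<kappa>_\<gamma>[OF that(1)] \<kappa>_\<gamma>[OF that(2)] \<gamma>(3) by blast
      hence "c (f ` e) = 0 \<longleftrightarrow> c (f ` e') = 0" using edge[OF that(1)] edge[OF that(2)] by simp
      ultimately show ?thesis by linarith
    qed
    have "eo_monochromatic c (EOGraph (f ` verts G) E (eord K \<inter> E \<times> E))"
      unfolding eo_monochromatic_def E_def eograph.sel
      by (intro ballI, elim imageE, hypsubst, rule same)
    with copy show "\<exists>H. eo_copy G H K \<and> eo_monochromatic c H" by blast
  qed
  ultimately show ?thesis using \<open>N > 0\<close> by blast
qed

section \<open>Finiteness of the Ramsey number\<close>

theorem theorem1:
  fixes G :: "'a eograph"
  assumes "edge_ordered_graph G"
  shows "edge_ordered_Ramsey G < \<infinity> \<and>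
    (\<exists>N>0. \<exists>K. edge_ordering_of_complete N K \<and>
       (\<forall>c. edge_coloring 2 K c \<longrightarrow> (\<exists>H. eo_copy G H K \<and> eo_monochromatic c H)))"
proof
  obtain N K where N: "N > 0" "edge_ordering_of_complete N K" "eo_arrows K G"
    using edge_ordered_arrowing[OF assms] by blast
  hence "edge_ordered_Ramsey G \<le> enat N"
    unfolding edge_ordered_Ramsey_def by (intro Inf_lower) blast
  also have "enat N < \<infinity>" by simp
  finally show "edge_ordered_Ramsey G < \<infinity>" .
  show "\<exists>N>0. \<exists>K. edge_ordering_of_complete N K \<and>
       (\<forall>c. edge_coloring 2 K c \<longrightarrow> (\<exists>H. eo_copy G H K \<and> eo_monochromatic c H))"
    using N unfolding eo_arrows_def by blast
qed

end
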